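(* For every positive integer $n$, the simplicial complex $\Delta([n])$ is shellable (in the non-pure sense); more precisely, listing the facets of $\Delta([n])$ as $F_1,F_2,\dots,F_t$ in lexicographic order, i.e. so that $F_1>_{lex}F_2>_{lex}\cdots>_{lex}F_t$, gives a shelling order.
   Context: Let $\mathbb{PP}$ be the set of prime powers $p^a$ ($p$ prime, $a\ge 1$) and $[n]=\{1,2,\dots,n\}$. $\Delta([n])$ is the simplicial complex whose vertex set is $[n]\cap\mathbb{PP}$ and in which a set $\sigma=\{q_1,\dots,q_s\}$ of prime powers is a simplex if and only if the $q_i$ are pairwise relatively prime and $q_1\cdots q_s\le n$ (the empty set is a simplex). Facets are the inclusion-maximal faces; a complex is pure if all its facets have the same dimension. For a face $\sigma$, $\overline{\sigma}=2^\sigma$ is the set of all subsets of $\sigma$. A simplicial complex is shellable (Björner–Wachs) if its facets can be arranged in a linear order $F_1,\dots,F_t$ (a shelling order) such that for every $k=2,\dots,t$ the subcomplex $\left(\bigcup_{i=1}^{k-1}\overline{F_i}\right)\cap\overline{F_k}$ is pure of dimension $\dim F_k-1$. The lexicographic order on finite subsets of $\mathbb{PP}$: for $\sigma=\{a_1<a_2<\dots<a_r\}$ and $\tau=\{b_1<b_2<\dots<b_s\}$, one has $\sigma\ge_{lex}\tau$ if $\tau=\emptyset$, or ($\sigma,\tau$ non-empty and) $a_1<b_1$, or $a_1=b_1$ and $\sigma\setminus\{a_1\}\ge_{lex}\tau\setminus\{b_1\}$. Thus for distinct facets, $\sigma>_{lex}\tau$ if and only if the smallest element of the symmetric difference of $\sigma$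 and $\tau$ belongs to $\sigma$. *)

theory Defs
  imports "HOL-Number_Theory.Number_Theory" "HOL-Number_Theory.Prime_Powers"
begin

text \<open>Abstract simplicial complexes are represented by their sets of faces; the empty face is included.\<close>

definition simplicial_complex :: "'a set set \<Rightarrow> bool" where
  "simplicial_complex K \<longleftrightarrow>
     {} \<in> K \<and> (\<forall>\<sigma>\<in>K. finite \<sigma>) \<and> (\<forall>\<sigma>\<in>K. \<forall>\<tau>. \<tau> \<subseteq> \<sigma> \<longrightarrow> \<tau> \<in> K)"

definition facets :: "'a set set \<Rightarrow> 'a set set" where
  "facets K = {F \<in> K. \<forall>G\<in>K. F \<subseteq> G \<longrightarrow> G = F}"

text \<open>Dimensions are integers because the empty face has dimension \<open>-1\<close>.\<close>

definition face_dim :: "'a set \<Rightarrow> int" where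
  "face_dim \<sigma> = int (card \<sigma>) - 1"

text \<open>Meaningful for non-empty finite complexes only, because of \<open>Max\<close>.\<close>

definition complex_dim :: "'a set set \<Rightarrow> int" where
  "complex_dim K = Max (face_dim ` K)"

definition pure_complex :: "'a set set \<Rightarrow> bool" where
  "pure_complex K \<longleftrightarrow> (\<forall>F\<in>facets K. \<forall>G\<in>facets K. face_dim F = face_dim G)"

text \<open>
  Lists are indexed from 0, so \<open>1 \<le> k\<close> below says that \<open>Fs ! k\<close> is not the first facet.
  The complex of all subsets of a face is \<open>Pow\<close>.
\<close>

definition shelling_order :: "'a set set \<Rightarrow> 'a set list \<Rightarrow> bool" where
  "shelling_order K Fs \<longleftrightarrow>
     distinct Fs \<and> set Fs = facets K \<and>
     (\<forall>k. 1 \<le> k \<and> k < length Fs \<longrightarrow>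
        (let L = (\<Union>i<k. Pow (Fs ! i)) \<inter> Pow (Fs ! k)
         in pure_complex L \<and> complex_dim L = face_dim (Fs ! k) - 1))"

definition shellable :: "'a set set \<Rightarrow> bool" where
  "shellable K \<longleftrightarrow> (\<exists>Fs. shelling_order K Fs)"

definition Delta :: "nat \<Rightarrow> nat set set" where
  "Delta n = {\<sigma>. \<sigma> \<subseteq> {q \<in> {1..n}. primepow q} \<and> pairwise coprime \<sigma> \<and> \<Prod>\<sigma> \<le> n}"

lemma Delta_subset_closed:
  assumes "\<sigma> \<in> Delta n" "\<tau> \<subseteq> \<sigma>"
  shows "\<tau> \<in> Delta n"
proof -
  have sub: "\<sigma> \<subseteq> {1..n}"
    using assms(1) by (auto simp: Delta_def)
  have fin: "finite \<sigma>"
    by (rule finite_subset[OF sub]) simp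
  have "\<Prod>\<tau> dvd \<Prod>\<sigma>"
    by (rule prod_dvd_prod_subset[OF fin assms(2)])
  moreover have "\<Prod>\<sigma> > 0"
    using sub by (intro prod_pos) auto
  ultimately have "\<Prod>\<tau> \<le> \<Prod>\<sigma>"
    by (rule dvd_imp_le)
  with assms show ?thesis
    by (auto simp: Delta_def intro: pairwise_subset)
qed

lemma simplicial_complex_Delta: "n \<ge> 1 \<Longrightarrow> simplicial_complex (Delta n)"
  unfolding simplicial_complex_def
proof (intro conjI ballI allI impI)
  show "{} \<in> Delta n" if "n \<ge> 1"
    using that by (simp add: Delta_def)
  show "finite \<sigma>" if "\<sigma> \<in> Delta n" for \<sigma>
  proof (rule finite_subset)
    show "\<sigma> \<subseteq> {1..n}" using that by (auto simp: Delta_def)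
  qed simp
qed (rule Delta_subset_closed)

lemma vertices_Delta: "\<Union> (Delta n) = {q \<in> {1..n}. primepow q}"
proof
  show "{q \<in> {1..n}. primepow q} \<subseteq> \<Union> (Delta n)"
  proof
    fix q assume "q \<in> {q \<in> {1..n}. primepow q}"
    then have "{q} \<in> Delta n" by (simp add: Delta_def)
    then show "q \<in> \<Union> (Delta n)" by blast
  qed
qed (auto simp: Delta_def)

lemma finite_Delta: "finite (Delta n)"
  by (rule finite_subset[of _ "Pow {1..n}"]) (auto simp: Delta_def)

inductive lex_ge :: "nat set \<Rightarrow> nat set \<Rightarrow> bool" where
  empty: "finite \<sigma> \<Longrightarrow> lex_ge \<sigma> {}"
| less: "\<lbrakk>finite \<sigma>; finite \<tau>; \<sigma> \<noteq> {}; \<tau> \<noteq> {}; Min \<sigma> < Min \<tau>\<rbrakk> \<Longrightarrow> lex_ge \<sigma> \<tau>"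
| eq: "\<lbrakk>finite \<sigma>; finite \<tau>; \<sigma> \<noteq> {}; \<tau> \<noteq> {}; Min \<sigma> = Min \<tau>;
        lex_ge (\<sigma> - {Min \<sigma>}) (\<tau> - {Min \<tau>})\<rbrakk> \<Longrightarrow> lex_ge \<sigma> \<tau>"

definition lex_gt :: "nat set \<Rightarrow> nat set \<Rightarrow> bool" where
  "lex_gt \<sigma> \<tau> \<longleftrightarrow> lex_ge \<sigma> \<tau> \<and> \<sigma> \<noteq> \<tau>"

lemma lex_ge_cases_diff:
  assumes "lex_ge \<sigma> \<tau>"
  shows "\<sigma> = \<tau> \<or> (\<exists>m\<in>\<sigma> - \<tau>. \<forall>x<m. x \<in> \<sigma> \<longleftrightarrow> x \<in> \<tau>)"
  using assms
proof induction
  case (empty \<sigma>)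
  show ?case
  proof (cases "\<sigma> = {}")
    case False
    with empty have "Min \<sigma> \<in> \<sigma>" "\<forall>x<Min \<sigma>. x \<notin> \<sigma>"
      by (auto dest: Min_le)
    then show ?thesis by auto
  qed simp
next
  case (less \<sigma> \<tau>)
  have lb: "\<And>x. x \<in> \<sigma> \<Longrightarrow> Min \<sigma> \<le> x" "\<And>x. x \<in> \<tau> \<Longrightarrow> Min \<tau> \<le> x"
    using less by auto
  have "Min \<sigma> \<in> \<sigma>" using less by auto
  moreover have "Min \<sigma> \<notin> \<tau>" using lb(2)[of "Min \<sigma>"] less by linarith
  moreover have "x \<notin> \<sigma> \<and> x \<notin> \<tau>" if "x < Min \<sigma>" for x
    using lb[of x] less that by linarith
  ultimately show ?case by blast
next
  case (eq \<sigma> \<tau>)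
  define a where "a = Min \<sigma>"
  have a: "a \<in> \<sigma>" "a \<in> \<tau>"
    using eq Min_in[of \<sigma>] Min_in[of \<tau>] by (auto simp: a_def)
  have IH: "\<sigma> - {a} = \<tau> - {a} \<or>
      (\<exists>m\<in>(\<sigma> - {a}) - (\<tau> - {a}). \<forall>x<m. x \<in> \<sigma> - {a} \<longleftrightarrow> x \<in> \<tau> - {a})"
    using eq by (simp add: a_def)
  then show ?case
    using a by blast
qed

lemma lex_ge_if_diff:
  assumes "finite \<sigma>" "finite \<tau>" "m \<in> \<sigma> - \<tau>" "\<forall>x<m. x \<in> \<sigma> \<longleftrightarrow> x \<in> \<tau>"
  shows "lex_ge \<sigma> \<tau>"
  using assms
proof (induction "card \<sigma>" arbitrary: \<sigma> \<tau>)
  case 0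
  then show ?case by simp
next
  case (Suc k)
  show ?case
  proof (cases "\<tau> = {}")
    case True
    then show ?thesis using Suc.prems by (simp add: lex_ge.empty)
  next
    case ne: False
    have ne': "\<sigma> \<noteq> {}" using Suc.prems by auto
    have mem: "Min \<sigma> \<in> \<sigma>" "Min \<tau> \<in> \<tau>"
      using Suc.prems ne ne' by auto
    have lb: "\<And>x. x \<in> \<sigma> \<Longrightarrow> Min \<sigma> \<le> x" "\<And>x. x \<in> \<tau> \<Longrightarrow> Min \<tau> \<le> x"
      using Suc.prems by auto
    have le: "Min \<sigma> \<le> m"
      using lb Suc.prems by auto
    show ?thesis
    proof (cases "Min \<sigma> < Min \<tau>")
      case True
      then show ?thesis using Suc.prems ne ne' by (intro lex_ge.less)
    next
      case False
      then have "Min \<tau> \<le> Min \<sigma>" by simp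
      moreover have "Min \<tau> \<noteq> m" using mem Suc.prems by auto
      ultimately have "Min \<tau> < m" using le by simp
      then have "Min \<tau> \<in> \<sigma>" using Suc.prems(4) mem by blast
      then have eq: "Min \<sigma> = Min \<tau>"
        using lb(1) \<open>Min \<tau> \<le> Min \<sigma>\<close> by (simp add: order_antisym)
      have "lex_ge (\<sigma> - {Min \<sigma>}) (\<tau> - {Min \<sigma>})"
      proof (rule Suc.hyps(1))
        show "k = card (\<sigma> - {Min \<sigma>})"
          using Suc.hyps(2) Suc.prems(1) mem(1) by simp
        show "m \<in> \<sigma> - {Min \<sigma>} - (\<tau> - {Min \<sigma>})"
          using Suc.prems(3) \<open>Min \<tau> < m\<close> eq by auto
      qed (use Suc.prems in auto)
      then show ?thesis
        using lex_ge.eq[OF Suc.prems(1,2) ne' ne eq] eq by simp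
    qed
  qed
qed

lemma lex_gt_iff_diff:
  assumes "finite \<sigma>" "finite \<tau>"
  shows "lex_gt \<sigma> \<tau> \<longleftrightarrow> (\<exists>m\<in>\<sigma> - \<tau>. \<forall>x<m. x \<in> \<sigma> \<longleftrightarrow> x \<in> \<tau>)"
proof
  assume "lex_gt \<sigma> \<tau>"
  then show "\<exists>m\<in>\<sigma> - \<tau>. \<forall>x<m. x \<in> \<sigma> \<longleftrightarrow> x \<in> \<tau>"
    using lex_ge_cases_diff[of \<sigma> \<tau>] unfolding lex_gt_def by blast
next
  assume "\<exists>m\<in>\<sigma> - \<tau>. \<forall>x<m. x \<in> \<sigma> \<longleftrightarrow> x \<in> \<tau>"
  then obtain m where m: "m \<in> \<sigma> - \<tau>" "\<forall>x<m. x \<in> \<sigma> \<longleftrightarrow> x \<in> \<tau>"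
    by blast
  then show "lex_gt \<sigma> \<tau>"
    using lex_ge_if_diff[OF assms m] unfolding lex_gt_def by blast
qed

lemma lex_gt_trans:
  assumes "finite \<sigma>" "finite \<tau>" "finite \<rho>" "lex_gt \<sigma> \<tau>" "lex_gt \<tau> \<rho>"
  shows "lex_gt \<sigma> \<rho>"
proof -
  obtain m where m: "m \<in> \<sigma> - \<tau>" "\<forall>x<m. x \<in> \<sigma> \<longleftrightarrow> x \<in> \<tau>"
    using assms(4) unfolding lex_gt_iff_diff[OF assms(1,2)] by blast
  obtain k where k: "k \<in> \<tau> - \<rho>" "\<forall>x<k. x \<in> \<tau> \<longleftrightarrow> x \<in> \<rho>"
    using assms(5) unfolding lex_gt_iff_diff[OF assms(2,3)] by blast
  have "m \<noteq> k" using m k by auto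
  then have "min m k \<in> \<sigma> - \<rho>"
    using m k by (cases "m < k") auto
  moreover have "\<forall>x<min m k. x \<in> \<sigma> \<longleftrightarrow> x \<in> \<rho>"
    using m k by simp
  ultimately show ?thesis
    unfolding lex_gt_iff_diff[OF assms(1,3)] by blast
qed

lemma lex_gt_total:
  assumes "finite \<sigma>" "finite \<tau>" "\<sigma> \<noteq> \<tau>"
  shows "lex_gt \<sigma> \<tau> \<or> lex_gt \<tau> \<sigma>"
proof -
  define m where "m = (LEAST x. (x \<in> \<sigma>) \<noteq> (x \<in> \<tau>))"
  have ex: "\<exists>x. (x \<in> \<sigma>) \<noteq> (x \<in> \<tau>)" using assms(3) by blast
  have "(m \<in> \<sigma>) \<noteq> (m \<in> \<tau>)"
    unfolding m_def using ex by (rule LeastI_ex)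
  moreover have "\<forall>x<m. x \<in> \<sigma> \<longleftrightarrow> x \<in> \<tau>"
    unfolding m_def using not_less_Least by blast
  ultimately show ?thesis
    unfolding lex_gt_iff_diff[OF assms(1,2)] lex_gt_iff_diff[OF assms(2,1)] by blast
qed

lemma ex_lex_listing:
  assumes "finite S" "\<forall>\<sigma>\<in>S. finite \<sigma>"
  shows "\<exists>Fs. set Fs = S \<and> sorted_wrt lex_gt Fs"
  using assms
proof (induction S rule: finite_induct)
  case empty
  then show ?case by simp
next
  case (insert \<rho> S)
  then obtain Fs where Fs: "set Fs = S" "sorted_wrt lex_gt Fs" by auto
  define Gs where "Gs = filter (\<lambda>\<sigma>. lex_gt \<sigma> \<rho>) Fs @ \<rho> # filter (lex_gt \<rho>) Fs"
  have "set Gs = insert \<rho> S"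
  proof -
    have "lex_gt \<sigma> \<rho> \<or> lex_gt \<rho> \<sigma>" if "\<sigma> \<in> S" for \<sigma>
      using insert.prems insert.hyps(2) that by (intro lex_gt_total) auto
    then show ?thesis
      unfolding Gs_def using Fs(1) by auto
  qed
  moreover have "sorted_wrt lex_gt Gs"
    using Fs insert.prems
    by (auto simp: Gs_def sorted_wrt_append sorted_wrt_filter intro: lex_gt_trans[where \<tau> = \<rho>])
  ultimately show ?case by blast
qed

lemma ex_lex_listing_facets_Delta:
  "\<exists>Fs. set Fs = facets (Delta n) \<and> sorted_wrt lex_gt Fs"
proof (rule ex_lex_listing)
  show "finite (facets (Delta n))"
    by (rule finite_subset[OF _ finite_Delta[of n]]) (auto simp: facets_def)
  show "\<forall>\<sigma>\<in>facets (Delta n). finite \<sigma>"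
  proof
    fix \<sigma> assume "\<sigma> \<in> facets (Delta n)"
    then have "\<sigma> \<subseteq> {1..n}" by (auto simp: facets_def Delta_def)
    then show "finite \<sigma>" by (rule finite_subset) simp
  qed
qed

end

theory Submission
  imports Defs
begin

text \<open>
  The proof rests on one exchange step.  Let \<open>\<tau>\<close> precede \<open>\<sigma>\<close> lexicographically and let \<open>m\<close> be
  the smallest element in which they differ, so \<open>m \<in> \<tau> - \<sigma>\<close>, and every element of
  \<open>\<sigma> - \<tau>\<close> exceeds \<open>m\<close>.  Being a power of a single prime, \<open>m\<close> fails to be coprime to at most one
  element of \<open>\<sigma>\<close>; such an element cannot lie in \<open>\<tau>\<close>.  Hence some \<open>b \<in> \<sigma> - \<tau>\<close> can be traded for
  \<open>m\<close>: the set \<open>\<sigma> - {b} \<union> {m}\<close> is still pairwise coprime, and its product has decreased because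
  \<open>m < b\<close>.  Any facet \<open>\<rho>\<close> containing this set precedes \<open>\<sigma>\<close>, since all elements of \<open>\<sigma>\<close> below \<open>m\<close>
  were kept; and \<open>\<rho>\<close> avoids \<open>b\<close>, since otherwise it would properly contain the facet \<open>\<sigma>\<close>.
  So \<open>\<sigma> \<inter> \<tau>\<close> lies in \<open>\<sigma> \<inter> \<rho> = \<sigma> - {b}\<close> (\<open>Delta_lex_exchange\<close>).

  This is the usual pairwise criterion for non-pure shellability: each face that \<open>\<sigma>\<close> shares
  with an earlier facet extends to a shared face of codimension one in \<open>\<sigma>\<close>
  (\<open>shelling_orderI\<close>).
\<close>

lemma face_in_facet:
  assumes "finite K" "\<sigma> \<in> K"
  obtains F where "F \<in> facets K" "\<sigma> \<subseteq> F"
proof -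
  obtain F where "F \<in> K" "\<sigma> \<subseteq> F" "\<forall>G\<in>K. F \<subseteq> G \<longrightarrow> F = G"
    using finite_has_maximal2[OF assms] by blast
  then show ?thesis
    by (intro that) (auto simp: facets_def)
qed

text \<open>
  Purity and dimension together amount to \<open>L\<close> being generated by codimension-one faces of \<open>F\<close>.
  Non-emptiness of \<open>L\<close> excludes the empty complex, whose dimension is not meaningful.
\<close>

lemma pure_codim_one_if_covered:
  assumes fin: "finite F" and "L \<noteq> {}" and sub: "L \<subseteq> Pow F"
    and cover: "\<And>\<sigma>. \<sigma> \<in> L \<Longrightarrow> \<exists>x\<in>F. \<sigma> \<subseteq> F - {x} \<and> F - {x} \<in> L"
  shows "pure_complex L" and "complex_dim L = face_dim F - 1"
proof -
  have dim: "face_dim (F - {x}) = face_dim F - 1" if "x \<in> F" for x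
    using card_Suc_Diff1[OF fin that] by (simp add: face_dim_def)
  have "face_dim \<sigma> = face_dim F - 1" if "\<sigma> \<in> facets L" for \<sigma>
  proof -
    have "\<sigma> \<in> L" using that by (simp add: facets_def)
    then obtain x where "x \<in> F" "\<sigma> \<subseteq> F - {x}" "F - {x} \<in> L" using cover by blast
    then show ?thesis using that dim by (auto simp: facets_def)
  qed
  then show "pure_complex L" by (simp add: pure_complex_def)
  have "finite L" using fin sub by (meson finite_Pow_iff finite_subset)
  obtain x where x: "x \<in> F" "F - {x} \<in> L" using \<open>L \<noteq> {}\<close> cover by blast
  have "face_dim \<sigma> \<le> face_dim F - 1" if \<sigma>: "\<sigma> \<in> L" for \<sigma>
  proof -
    obtain y where y: "y \<in> F" "\<sigma> \<subseteq> F - {y}" using cover[OF \<sigma>] by blast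
    then have "card \<sigma> \<le> card (F - {y})" using fin by (intro card_mono) auto
    then show ?thesis using dim[OF y(1)] by (simp add: face_dim_def)
  qed
  moreover have "face_dim F - 1 \<in> face_dim ` L" using x dim by force
  ultimately show "complex_dim L = face_dim F - 1"
    unfolding complex_dim_def using \<open>finite L\<close> by (intro Max_eqI) auto
qed

text \<open>
  The pairwise form of the shelling condition, which reduces shellability to comparing two facets
  at a time.
\<close>

lemma shelling_orderI:
  assumes "distinct Fs" "set Fs = facets K" and fin: "\<And>F. F \<in> facets K \<Longrightarrow> finite F"
    and exchange: "\<And>i k. i < k \<Longrightarrow> k < length Fs \<Longrightarrow>
      \<exists>j<k. \<exists>x\<in>Fs ! k. Fs ! k \<inter> Fs ! i \<subseteq> Fs ! k - {x} \<and> Fs ! k - {x} \<subseteq> Fs ! j"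
  shows "shelling_order K Fs"
  unfolding shelling_order_def Let_def
proof (intro conjI allI impI)
  fix k assume k: "1 \<le> k \<and> k < length Fs"
  define L where "L = (\<Union>i<k. Pow (Fs ! i)) \<inter> Pow (Fs ! k)"
  have "finite (Fs ! k)" using k assms(2) fin nth_mem by blast
  moreover have "{} \<in> L" using k by (auto simp: L_def intro!: exI[of _ 0])
  moreover have "\<exists>x\<in>Fs ! k. \<sigma> \<subseteq> Fs ! k - {x} \<and> Fs ! k - {x} \<in> L" if \<sigma>: "\<sigma> \<in> L" for \<sigma>
  proof -
    obtain i where i: "i < k" "\<sigma> \<subseteq> Fs ! k \<inter> Fs ! i" using \<sigma> by (auto simp: L_def)
    then obtain j x where "j < k" "x \<in> Fs ! k" "Fs ! k \<inter> Fs ! i \<subseteq> Fs ! k - {x}"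
        "Fs ! k - {x} \<subseteq> Fs ! j"
      using exchange[of i k] k by blast
    moreover from this have "Fs ! k - {x} \<in> L" by (auto simp: L_def)
    ultimately show ?thesis using i(2) by blast
  qed
  ultimately have "pure_complex L \<and> complex_dim L = face_dim (Fs ! k) - 1"
    using pure_codim_one_if_covered[of "Fs ! k" L] by (auto simp: L_def)
  then show "pure_complex ((\<Union>i<k. Pow (Fs ! i)) \<inter> Pow (Fs ! k))"
    and "complex_dim ((\<Union>i<k. Pow (Fs ! i)) \<inter> Pow (Fs ! k)) = face_dim (Fs ! k) - 1"
    by (simp_all add: L_def)
qed (use assms in auto)

lemma finite_Delta_face: "\<sigma> \<in> Delta n \<Longrightarrow> finite \<sigma>"
  by (rule finite_subset[of _ "{1..n}"]) (auto simp: Delta_def)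

text \<open>
  All elements not coprime to \<open>m\<close> are divisible by the one prime underlying \<open>m\<close>.
\<close>

lemma non_coprime_primepow_unique:
  fixes m :: nat
  assumes "primepow m" "pairwise coprime \<sigma>" "b \<in> \<sigma>" "c \<in> \<sigma>" "\<not> coprime m b" "\<not> coprime m c"
  shows "b = c"
proof (rule ccontr)
  assume "b \<noteq> c"
  then have bc: "coprime b c" using assms by (auto simp: pairwise_def)
  obtain p k where p: "prime p" "m = p ^ k" using assms(1) by (auto simp: primepow_def)
  have "p dvd x" if "\<not> coprime m x" for x
    using that p prime_imp_coprime[of p x] by auto
  then have "p dvd b" "p dvd c" using assms by auto
  then have "is_unit p" using bc coprime_common_divisor by blast
  then show False using p(1) not_prime_unit by blast
qed

text \<open>
  The product bound survives the exchange because the product without \<open>b\<close> is multiplied by the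
  smaller number \<open>m\<close>.
\<close>

lemma Delta_replace_by_smaller:
  assumes \<sigma>: "\<sigma> \<in> Delta n" and b: "b \<in> \<sigma>" "m < b" and "m \<notin> \<sigma>" and "primepow m"
    and cop: "\<And>c. c \<in> \<sigma> - {b} \<Longrightarrow> coprime m c"
  shows "insert m (\<sigma> - {b}) \<in> Delta n"
proof -
  have fin: "finite \<sigma>" using \<sigma> by (rule finite_Delta_face)
  have s: "\<sigma> \<subseteq> {q \<in> {1..n}. primepow q}" "pairwise coprime \<sigma>" "\<Prod>\<sigma> \<le> n"
    using \<sigma> by (auto simp: Delta_def)
  have "b \<le> n" using s b by auto
  then have "insert m (\<sigma> - {b}) \<subseteq> {q \<in> {1..n}. primepow q}"
    using s(1) b \<open>primepow m\<close> primepow_gt_Suc_0[of m] by auto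
  moreover have "pairwise coprime (insert m (\<sigma> - {b}))"
    using s(2) cop by (auto simp: pairwise_insert coprime_commute intro: pairwise_subset)
  moreover have "\<Prod>(insert m (\<sigma> - {b})) \<le> n"
  proof -
    have "\<Prod>(insert m (\<sigma> - {b})) = m * \<Prod>(\<sigma> - {b})" using fin \<open>m \<notin> \<sigma>\<close> by simp
    also have "\<dots> \<le> b * \<Prod>(\<sigma> - {b})" using b by simp
    also have "\<dots> = \<Prod>\<sigma>" using prod.remove[OF fin b(1), of "\<lambda>x. x"] by simp
    finally show ?thesis using s by simp
  qed
  ultimately show ?thesis by (auto simp: Delta_def)
qed

lemma Delta_lex_exchange:
  assumes \<sigma>: "\<sigma> \<in> facets (Delta n)" and \<tau>: "\<tau> \<in> facets (Delta n)" and gt: "lex_gt \<tau> \<sigma>"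
  obtains \<rho> b where "\<rho> \<in> facets (Delta n)" "lex_gt \<rho> \<sigma>" "b \<in> \<sigma> - \<tau>" "\<sigma> - {b} \<subseteq> \<rho>"
proof -
  have faces: "\<sigma> \<in> Delta n" "\<tau> \<in> Delta n" using \<sigma> \<tau> by (auto simp: facets_def)
  have max: "G = \<sigma>" if "G \<in> Delta n" "\<sigma> \<subseteq> G" for G
    using \<sigma> that by (auto simp: facets_def)
  have fin: "finite \<sigma>" "finite \<tau>" using faces finite_Delta_face by auto
  obtain m where m: "m \<in> \<tau> - \<sigma>" "\<forall>x<m. x \<in> \<tau> \<longleftrightarrow> x \<in> \<sigma>"
    using gt unfolding lex_gt_iff_diff[OF fin(2,1)] by blast
  have "primepow m" using m faces(2) by (auto simp: Delta_def)
  have cop_\<sigma>: "pairwise coprime \<sigma>" and cop_\<tau>: "pairwise coprime \<tau>"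
    using faces by (auto simp: Delta_def)
  \<comment> \<open>If \<open>m\<close> has a common factor with an element of \<open>\<sigma>\<close>, that element must be the one to go;
    otherwise any element of \<open>\<sigma> - \<tau>\<close> will do.\<close>
  obtain b where b: "b \<in> \<sigma> - \<tau>" and cop: "\<And>c. c \<in> \<sigma> - {b} \<Longrightarrow> coprime m c"
  proof (cases "\<exists>b\<in>\<sigma>. \<not> coprime m b")
    case True
    then obtain b where b: "b \<in> \<sigma>" "\<not> coprime m b" by blast
    have "b \<notin> \<tau>" using b m cop_\<tau> by (auto simp: pairwise_def)
    moreover have "coprime m c" if "c \<in> \<sigma> - {b}" for c
      using non_coprime_primepow_unique[OF \<open>primepow m\<close> cop_\<sigma>, of b c] b that by blast
    ultimately show ?thesis using b that by blast
  next
    case False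
    obtain b where "b \<in> \<sigma> - \<tau>" using max[OF faces(2)] m(1) by blast
    with False that show ?thesis by blast
  qed
  have "m < b" using b m by (metis DiffD1 DiffD2 linorder_neqE_nat)
  then have "insert m (\<sigma> - {b}) \<in> Delta n"
    using faces(1) b m cop \<open>primepow m\<close> by (intro Delta_replace_by_smaller) auto
  then obtain \<rho> where \<rho>: "\<rho> \<in> facets (Delta n)" "insert m (\<sigma> - {b}) \<subseteq> \<rho>"
    using face_in_facet[OF finite_Delta] by metis
  have "\<rho> \<in> Delta n" using \<rho> by (simp add: facets_def)
  have "lex_gt \<rho> \<sigma>"
  proof (rule ccontr)
    assume "\<not> lex_gt \<rho> \<sigma>"
    moreover have "\<rho> \<noteq> \<sigma>" using \<rho> m by blast
    ultimately have "lex_gt \<sigma> \<rho>"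
      using lex_gt_total finite_Delta_face[OF \<open>\<rho> \<in> Delta n\<close>] fin(1) by blast
    then obtain d where d: "d \<in> \<sigma> - \<rho>" "\<forall>x<d. x \<in> \<sigma> \<longleftrightarrow> x \<in> \<rho>"
      using lex_gt_iff_diff[OF fin(1) finite_Delta_face[OF \<open>\<rho> \<in> Delta n\<close>]] by blast
    \<comment> \<open>Only \<open>b\<close> can be missing from \<open>\<rho>\<close>, but \<open>\<rho>\<close> and \<open>\<sigma>\<close> already differ at \<open>m < b\<close>.\<close>
    then have "d = b" using \<rho> by blast
    then show False using d \<open>m < b\<close> m \<rho> by blast
  qed
  then show ?thesis using that[of \<rho> b] \<rho> b by blast
qed

theorem theorem6p9:
  fixes n :: nat
  assumes "n \<ge> 1"
  shows "shellable (Delta n) \<and>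
    (\<forall>Fs. set Fs = facets (Delta n) \<and> sorted_wrt lex_gt Fs \<longrightarrow> shelling_order (Delta n) Fs)"
proof -
  have shelling: "shelling_order (Delta n) Fs"
    if Fs: "set Fs = facets (Delta n)" and sorted: "sorted_wrt lex_gt Fs" for Fs
  proof (rule shelling_orderI)
    show "distinct Fs"
      using sorted by (metis (no_types, lifting) distinct_conv_nth lex_gt_def linorder_neqE_nat
          sorted_wrt_iff_nth_less)
    show "set Fs = facets (Delta n)" by fact
    show fin: "finite F" if "F \<in> facets (Delta n)" for F
      using that finite_Delta_face by (auto simp: facets_def)
    fix i k assume ik: "i < k" "k < length Fs"
    then have mem: "Fs ! k \<in> facets (Delta n)" "Fs ! i \<in> facets (Delta n)"
      using Fs nth_mem[of _ Fs] by auto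
    have "lex_gt (Fs ! i) (Fs ! k)" using sorted ik by (simp add: sorted_wrt_iff_nth_less)
    then obtain \<rho> b where \<rho>: "\<rho> \<in> facets (Delta n)" "lex_gt \<rho> (Fs ! k)"
        and b: "b \<in> Fs ! k - Fs ! i" "Fs ! k - {b} \<subseteq> \<rho>"
      using Delta_lex_exchange[OF mem] by blast
    obtain j where j: "j < length Fs" "\<rho> = Fs ! j" using \<rho>(1) Fs by (metis in_set_conv_nth)
    have "j < k"
    proof (rule ccontr)
      assume "\<not> j < k"
      moreover have "j \<noteq> k" using \<rho>(2) j by (auto simp: lex_gt_def)
      ultimately have "lex_gt (Fs ! k) \<rho>" using sorted j by (simp add: sorted_wrt_iff_nth_less)
      then have "lex_gt \<rho> \<rho>" using lex_gt_trans \<rho> fin mem by blast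
      then show False by (simp add: lex_gt_def)
    qed
    then show "\<exists>j<k. \<exists>x\<in>Fs ! k. Fs ! k \<inter> Fs ! i \<subseteq> Fs ! k - {x} \<and> Fs ! k - {x} \<subseteq> Fs ! j"
      using b j by blast
  qed
  moreover have "shellable (Delta n)"
    using ex_lex_listing_facets_Delta[of n] shelling unfolding shellable_def by blast
  ultimately show ?thesis by blast
qed

end
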